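(* Suppose that the vector fields $f$ and $g$, where $f(y)=Ky+g(y)$ on $\mathbb{R}^n$, both belong to $\mathcal S$ with the same $P$; that is, there is an invertible matrix $P$ such that $Pf'(y)P^{-1}=-f'(y)$ and $Pg'(y)P^{-1}=-g'(y)$ for all $y$. Then all one-stage SSEI methods and all two-stage SSEI methods with $c_1=c_2$ (and any composition of such methods) for solving $y'=Ky+g(y)$ are volume preserving.
   Context: The ODE is $y'(t)=Ky(t)+g(y(t))=:f(y(t))$ on $\mathbb{R}^n$, where $K$ is a real $n\times n$ matrix with $|e^{hK}|\neq-1$ for $0<h<1$, and $g:\mathbb{R}^n\to\mathbb{R}^n$ is differentiable; $f$ is assumed divergence free. $|\cdot|$ denotes the determinant. $\mathcal S$ is the class of vector fields $f$ for which there exists an invertible matrix $P$ with $Pf'(y)P^{-1}=-f'(y)$ for all $y$. SSEI (special symplectic exponential integrator) method: let $c=(c_1,\dots,c_s)^{\intercal}$, $b=(b_1,\dots,b_s)^{\intercal}$, $A=(a_{ij})_{s\times s}$ be the coefficients of an $s$-stage Runge--Kutta method which is symplectic, i.e. $b_ia_{ij}+b_ja_{ji}-b_ib_j=0$ for all $i,j$, and satisfies $b_j\neq0$ for all $j$. The corresponding $s$-stage SSEI method with stepsize $h$ is the map $$\varphi_h(y)=e^{hK}y+h\sum_{i=1}^{s}b_ie^{(1-c_i)hK}g(k_i(y)),\qquad k_i(y)=e^{c_ihK}y+h\sum_{j=1}^{s}a_{ij}e^{(c_i-c_j)hK}g(k_j(y)),\quad i=1,\dots,s.$$ It is understood that the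 stage equations define $k_1,\dots,k_s$ as differentiable functions of $y$ and that the $sn\times sn$ matrix with $n\times n$ blocks $\delta_{ij}I-h\,a_{ij}e^{(c_i-c_j)hK}g'(k_j)$ is invertible. A method is volume preserving if its one-step map has Jacobian determinant $1$ at every $y$. *)

theory Defs
  imports "HOL-Analysis.Analysis"
begin

definition mat_exp :: "real^'n^'n \<Rightarrow> real^'n^'n" where
  "mat_exp M = (\<Sum>k. (1 / fact k) *\<^sub>R (((**) M ^^ k) (mat 1)))"

definition divergence_free :: "(real^'n \<Rightarrow> real^'n) \<Rightarrow> bool" where
  "divergence_free f \<longleftrightarrow>
     (\<forall>y. f differentiable (at y) \<and> trace (jacobian f (at y)) = 0)"

text \<open>The vector fields in the class \<open>\<S>\<close> for which the invertible matrix \<open>P\<close> is a witness;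
  the class \<open>\<S>\<close> itself is the union over all \<open>P\<close>.\<close>

definition class_S_with :: "real^'n^'n \<Rightarrow> (real^'n \<Rightarrow> real^'n) set" where
  "class_S_with P = {f. invertible P \<and>
     (\<forall>y. f differentiable (at y) \<and>
          P ** jacobian f (at y) ** matrix_inv P = - jacobian f (at y))}"

definition class_S :: "(real^'n \<Rightarrow> real^'n) set" where
  "class_S = (\<Union>P. class_S_with P)"

definition volume_preserving :: "(real^'n \<Rightarrow> real^'n) \<Rightarrow> bool" where
  "volume_preserving \<phi> \<longleftrightarrow>
     (\<forall>y. \<phi> differentiable (at y) \<and> det (jacobian \<phi> (at y)) = 1)"

definition block_matrix :: "('s \<Rightarrow> 's \<Rightarrow> real^'n^'n) \<Rightarrow> real^('s::finite \<times> 'n)^('s \<times> 'n)" where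
  "block_matrix B = (\<chi> p q. B (fst p) (fst q) $ snd p $ snd q)"

text \<open>Runge--Kutta coefficients are indexed by a finite type of stages \<open>'s\<close>, so an \<open>s\<close>-stage
  method has \<open>CARD('s) = s\<close>.\<close>

definition symplectic_RK :: "real^'s \<Rightarrow> real^'s^'s \<Rightarrow> bool" where
  "symplectic_RK b A \<longleftrightarrow> (\<forall>i j. b$i * A$i$j + b$j * A$j$i - b$i * b$j = 0)"

text \<open>\<open>k i y\<close> is the \<open>i\<close>-th stage at \<open>y\<close>. The stages are only required to be some globally
  defined differentiable solution of the implicit stage equations.\<close>

definition SSEI_stages ::
  "real^'n^'n \<Rightarrow> (real^'n \<Rightarrow> real^'n) \<Rightarrow> real \<Rightarrow> real^'s \<Rightarrow> real^'s^'s
    \<Rightarrow> ('s \<Rightarrow> real^'n \<Rightarrow> real^'n) \<Rightarrow> bool" where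
  "SSEI_stages K g h c A k \<longleftrightarrow>
     (\<forall>i y. k i y = mat_exp ((c$i * h) *\<^sub>R K) *v y
        + h *\<^sub>R (\<Sum>j\<in>UNIV. A$i$j *\<^sub>R (mat_exp (((c$i - c$j) * h) *\<^sub>R K) *v g (k j y)))) \<and>
     (\<forall>i y. k i differentiable (at y)) \<and>
     (\<forall>y. invertible (block_matrix (\<lambda>i j.
        (if i = j then mat 1 else 0)
        - (h * A$i$j) *\<^sub>R (mat_exp (((c$i - c$j) * h) *\<^sub>R K) ** jacobian g (at (k j y))))))"

definition SSEI_step ::
  "real^'n^'n \<Rightarrow> (real^'n \<Rightarrow> real^'n) \<Rightarrow> real \<Rightarrow> real^'s \<Rightarrow> real^'s
    \<Rightarrow> ('s \<Rightarrow> real^'n \<Rightarrow> real^'n) \<Rightarrow> real^'n \<Rightarrow> real^'n" where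
  "SSEI_step K g h c b k y = mat_exp (h *\<^sub>R K) *v y
     + h *\<^sub>R (\<Sum>i\<in>UNIV. b$i *\<^sub>R (mat_exp (((1 - c$i) * h) *\<^sub>R K) *v g (k i y)))"

definition SSEI_method ::
  "real^'n^'n \<Rightarrow> (real^'n \<Rightarrow> real^'n) \<Rightarrow> real \<Rightarrow> real^'s \<Rightarrow> real^'s \<Rightarrow> real^'s^'s
    \<Rightarrow> (real^'n \<Rightarrow> real^'n) \<Rightarrow> bool" where
  "SSEI_method K g h c b A \<phi> \<longleftrightarrow>
     symplectic_RK b A \<and> (\<forall>j. b$j \<noteq> 0) \<and>
     (\<exists>k. SSEI_stages K g h c A k \<and> \<phi> = SSEI_step K g h c b k)"

definition one_stage_SSEI ::
  "real^'n^'n \<Rightarrow> (real^'n \<Rightarrow> real^'n) \<Rightarrow> (real^'n \<Rightarrow> real^'n) set" where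
  "one_stage_SSEI K g =
     {\<phi>. \<exists>h (c :: real^1) b A. SSEI_method K g h c b A \<phi>}"

definition two_stage_SSEI_eq ::
  "real^'n^'n \<Rightarrow> (real^'n \<Rightarrow> real^'n) \<Rightarrow> (real^'n \<Rightarrow> real^'n) set" where
  "two_stage_SSEI_eq K g =
     {\<phi>. \<exists>h (c :: real^2) b A. c$1 = c$2 \<and> SSEI_method K g h c b A \<phi>}"

text \<open>All finite nonempty compositions of maps from \<open>M\<close>; the factors may differ in stage number,
  coefficients and stepsize.\<close>

inductive_set compositions :: "('a \<Rightarrow> 'a) set \<Rightarrow> ('a \<Rightarrow> 'a) set" for M where
  base: "\<phi> \<in> M \<Longrightarrow> \<phi> \<in> compositions M"
| comp: "\<phi> \<in> compositions M \<Longrightarrow> \<psi> \<in> compositions M \<Longrightarrow> \<phi> \<circ> \<psi> \<in> compositions M"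

end

theory Submission
  imports Defs
begin

text \<open>
  Subtracting the two conjugation hypotheses gives \<open>P K = - K P\<close>, so \<open>P\<close> reverses both the linear
  flow, \<open>P e\<^sup>t\<^sup>K = e\<^sup>-\<^sup>t\<^sup>K P\<close>, and the derivative of \<open>g\<close>. The first fact yields
  \<open>det e\<^sup>t\<^sup>K = det e\<^sup>-\<^sup>t\<^sup>K\<close>; as these numbers are inverse to each other and are squares, they
  equal 1 (\<open>det_mat_exp_eq_one\<close>).

  Differentiating the stage equations shows that the column of stage derivatives \<open>k\<^sub>i'\<close> solves a
  linear system whose matrix \<open>M\<close> has the blocks
  \<open>\<delta>\<^sub>i\<^sub>j I - h a\<^sub>i\<^sub>j Q\<^sub>i\<^sub>j G\<^sub>j\<close>, with \<open>Q\<^sub>i\<^sub>j\<close> the exponential of \<open>(c\<^sub>i - c\<^sub>j) h K\<close> and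
  \<open>G\<^sub>j = g'(k\<^sub>j)\<close>. The Jacobian of the step is \<open>e\<^sup>h\<^sup>K\<close> times a matrix \<open>I + V X\<close>, where \<open>X\<close> is this
  column and \<open>V\<close> a block row. Since \<open>det (I + V X) = det (I + X V)\<close> across different sizes
  (\<open>det_one_plus_commute\<close>), the Jacobian determinant times \<open>det M\<close> is the determinant of the
  matrix \<open>M\<close> with \<open>a\<^sub>i\<^sub>j\<close> replaced by \<open>a\<^sub>i\<^sub>j - b\<^sub>j\<close>. The symplecticity condition says
  \<open>a\<^sub>i\<^sub>j - b\<^sub>j = - (b\<^sub>j / b\<^sub>i) a\<^sub>j\<^sub>i\<close>; the factors \<open>b\<^sub>j / b\<^sub>i\<close> disappear under a diagonal
  similarity, and the remaining sign is removed by conjugating every block with \<open>P\<close>. The outcome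
  (\<open>det_SSEI_tangent\<close>), for any number of stages, is that the Jacobian determinant is the quotient
  of the stage determinants of the tableau with \<open>A\<close> transposed and \<open>c\<close> negated and of the
  original one.

  It remains to see that the two stage determinants agree. For one stage the two matrices are the
  same. For two stages with \<open>c\<^sub>1 = c\<^sub>2\<close> the exponentials are identities, and transposing \<open>A\<close>
  exchanges the scalar factors of the two off-diagonal blocks, which preserves the
  determinant (\<open>det_block_matrix_swap_two\<close>). Compositions follow from the chain rule.
\<close>

section \<open>Bilinearity of matrix multiplication\<close>

lemma bounded_bilinear_matrix_mult:
  "bounded_bilinear ((**) :: real^'n^'m \<Rightarrow> real^'p^'n \<Rightarrow> real^'p^'m)"
  unfolding bilinear_conv_bounded_bilinear[symmetric] bilinear_def
  by (auto intro!: linearI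
      simp: vec_eq_iff matrix_matrix_mult_def sum_distrib_left sum.distrib algebra_simps)

lemmas matrix_mult_simps =
  bounded_bilinear.add_left[OF bounded_bilinear_matrix_mult]
  bounded_bilinear.add_right[OF bounded_bilinear_matrix_mult]
  bounded_bilinear.diff_left[OF bounded_bilinear_matrix_mult]
  bounded_bilinear.diff_right[OF bounded_bilinear_matrix_mult]
  bounded_bilinear.minus_left[OF bounded_bilinear_matrix_mult]
  bounded_bilinear.minus_right[OF bounded_bilinear_matrix_mult]
  bounded_bilinear.scaleR_left[OF bounded_bilinear_matrix_mult]
  bounded_bilinear.scaleR_right[OF bounded_bilinear_matrix_mult]
  bounded_bilinear.sum_left[OF bounded_bilinear_matrix_mult]
  bounded_bilinear.sum_right[OF bounded_bilinear_matrix_mult]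
  bounded_bilinear.zero_left[OF bounded_bilinear_matrix_mult]
  bounded_bilinear.zero_right[OF bounded_bilinear_matrix_mult]

section \<open>The matrix exponential\<close>

abbreviation matpow :: "real^'n^'n \<Rightarrow> nat \<Rightarrow> real^'n^'n" where
  "matpow M k \<equiv> ((**) M ^^ k) (mat 1)"

lemma matpow_add: "matpow M (i + j) = matpow M i ** matpow M j"
  by (induction i) (simp_all add: matrix_mul_assoc)

lemma matpow_scaleR: "matpow (c *\<^sub>R M) k = c ^ k *\<^sub>R matpow M k"
  by (induction k) (simp_all add: matrix_mult_simps)

lemma abs_matpow_le:
  fixes M :: "real^'n^'n"
  shows "\<bar>matpow M k $ a $ b\<bar> \<le> (\<Sum>i\<in>UNIV. \<Sum>j\<in>UNIV. \<bar>M$i$j\<bar>) ^ k"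
proof (induction k arbitrary: a)
  case 0
  show ?case by (simp add: mat_def)
next
  case (Suc k)
  let ?R = "\<Sum>i\<in>UNIV. \<Sum>j\<in>UNIV. \<bar>M$i$j\<bar>"
  have R: "0 \<le> ?R" by (intro sum_nonneg) auto
  have row: "(\<Sum>l\<in>UNIV. \<bar>M$a$l\<bar>) \<le> ?R"
    by (rule member_le_sum[of a UNIV "\<lambda>i. \<Sum>l\<in>UNIV. \<bar>M$i$l\<bar>"]) (auto intro: sum_nonneg)
  have "\<bar>matpow M (Suc k) $ a $ b\<bar> = \<bar>\<Sum>l\<in>UNIV. M$a$l * matpow M k $ l $ b\<bar>"
    by (simp add: matrix_matrix_mult_def)
  also have "\<dots> \<le> (\<Sum>l\<in>UNIV. \<bar>M$a$l\<bar> * ?R ^ k)"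
    by (rule order.trans[OF sum_abs]) (auto simp: abs_mult intro!: sum_mono mult_left_mono Suc.IH)
  also have "\<dots> = (\<Sum>l\<in>UNIV. \<bar>M$a$l\<bar>) * ?R ^ k"
    by (simp add: sum_distrib_right)
  also have "\<dots> \<le> ?R ^ Suc k"
    using row R by (simp add: mult_right_mono)
  finally show ?case .
qed

lemma summable_abs_mat_exp_entry:
  fixes M :: "real^'n^'n"
  shows
  "summable (\<lambda>k. \<bar>1 / fact k * matpow M k $ a $ b\<bar>)"
proof (rule summable_comparison_test')
  let ?R = "\<Sum>i\<in>UNIV. \<Sum>j\<in>UNIV. \<bar>M$i$j\<bar>"
  show "summable (\<lambda>k. inverse (fact k) * ?R ^ k)" by (rule summable_exp)
  show "norm \<bar>1 / fact k * matpow M k $ a $ b\<bar> \<le> inverse (fact k) * ?R ^ k" for k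
    using abs_matpow_le[of k M a b] by (simp add: abs_mult divide_simps)
qed

lemma mat_exp_sums: "(\<lambda>k. (1 / fact k) *\<^sub>R matpow M k) sums mat_exp M"
proof -
  define L where "L = (\<chi> a b. \<Sum>k. 1 / fact k * matpow M k $ a $ b)"
  have *: "(\<lambda>k. 1 / fact k * matpow M k $ a $ b) sums (L $ a $ b)" for a b
    unfolding L_def
    using summable_sums[OF summable_rabs_cancel[OF summable_abs_mat_exp_entry[of M a b]]] by simp
  have "(\<lambda>k. (1 / fact k) *\<^sub>R matpow M k) sums L"
    unfolding sums_def
    by (intro vec_tendstoI) (use * in \<open>simp add: sums_def\<close>)
  then show ?thesis
    unfolding mat_exp_def by (simp add: sums_iff)
qed

lemma mat_exp_entry_sums:
  "(\<lambda>k. 1 / fact k * matpow M k $ a $ b) sums (mat_exp M $ a $ b)"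
  using mat_exp_sums[of M] unfolding sums_def
  by (auto dest!: tendsto_vec_nth[where i=b, OF tendsto_vec_nth[where i=a]])

lemma mat_exp_zero [simp]: "mat_exp 0 = mat 1"
proof -
  have z: "matpow (0 :: real^'n^'n) k = (if k = 0 then mat 1 else 0)" for k
    by (cases k) auto
  have "(\<lambda>k. (1 / fact k) *\<^sub>R matpow (0 :: real^'n^'n) k) sums (\<Sum>k\<in>{0}. (1 / fact k) *\<^sub>R matpow 0 k)"
    by (rule sums_finite) (auto simp: z)
  then show ?thesis
    using mat_exp_sums[of "0 :: real^'n^'n"] sums_unique2 by fastforce
qed

text \<open>Each entry of the product is a finite sum of products of absolutely convergent real series, to
  which the Cauchy product applies; the binomial theorem collects the coefficients.\<close>

lemma mat_exp_add:
  "mat_exp (s *\<^sub>R M) ** mat_exp (t *\<^sub>R M) = mat_exp ((s + t) *\<^sub>R M)"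
proof -
  have "(mat_exp (s *\<^sub>R M) ** mat_exp (t *\<^sub>R M)) $ a $ b = mat_exp ((s + t) *\<^sub>R M) $ a $ b" for a b
  proof -
    let ?u = "\<lambda>l k. 1 / fact k * matpow (s *\<^sub>R M) k $ a $ l"
    let ?v = "\<lambda>l k. 1 / fact k * matpow (t *\<^sub>R M) k $ l $ b"
    have "(\<lambda>k. \<Sum>i\<le>k. ?u l i * ?v l (k - i)) sums
        (mat_exp (s *\<^sub>R M) $ a $ l * mat_exp (t *\<^sub>R M) $ l $ b)" for l
      unfolding sums_unique[OF mat_exp_entry_sums]
      by (rule Cauchy_product_sums) (simp_all only: real_norm_def summable_abs_mat_exp_entry)
    then have "(\<lambda>k. \<Sum>l\<in>UNIV. \<Sum>i\<le>k. ?u l i * ?v l (k - i)) sums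
        ((mat_exp (s *\<^sub>R M) ** mat_exp (t *\<^sub>R M)) $ a $ b)"
      by (simp add: matrix_matrix_mult_def sums_sum)
    moreover have "(\<Sum>l\<in>UNIV. \<Sum>i\<le>k. ?u l i * ?v l (k - i)) =
        1 / fact k * matpow ((s + t) *\<^sub>R M) k $ a $ b" for k
    proof -
      have "(\<Sum>l\<in>UNIV. \<Sum>i\<le>k. ?u l i * ?v l (k - i)) =
          (\<Sum>i\<le>k. \<Sum>l\<in>UNIV. s ^ i * t ^ (k - i) / (fact i * fact (k - i)) *
             (matpow M i $ a $ l * matpow M (k - i) $ l $ b))"
        by (subst sum.swap) (simp add: matpow_scaleR mult_ac)
      also have "\<dots> = (\<Sum>i\<le>k. s ^ i * t ^ (k - i) / (fact i * fact (k - i)) * matpow M k $ a $ b)"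
      proof (rule sum.cong[OF refl])
        fix i assume "i \<in> {..k}"
        then have "matpow M k = matpow M i ** matpow M (k - i)"
          by (simp flip: matpow_add)
        then show "(\<Sum>l\<in>UNIV. s ^ i * t ^ (k - i) / (fact i * fact (k - i)) *
             (matpow M i $ a $ l * matpow M (k - i) $ l $ b)) =
             s ^ i * t ^ (k - i) / (fact i * fact (k - i)) * matpow M k $ a $ b"
          by (simp add: matrix_matrix_mult_def sum_distrib_left)
      qed
      also have "\<dots> = 1 / fact k * ((s + t) ^ k * matpow M k $ a $ b)"
        by (simp add: binomial_ring binomial_fact sum_distrib_left sum_distrib_right mult_ac)
      finally show ?thesis by (simp add: matpow_scaleR)
    qed
    ultimately have "(\<lambda>k. 1 / fact k * matpow ((s + t) *\<^sub>R M) k $ a $ b) sums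
        ((mat_exp (s *\<^sub>R M) ** mat_exp (t *\<^sub>R M)) $ a $ b)"
      by (simp only:)
    then show ?thesis using mat_exp_entry_sums by (rule sums_unique2)
  qed
  then show ?thesis by (simp add: vec_eq_iff)
qed

text \<open>A relation \<open>P X = Y P\<close> passes to all powers and, multiplication by \<open>P\<close> being continuous, to the
  exponential series.\<close>

lemma mat_exp_intertwine:
  fixes P :: "real^'n^'n"
  assumes "P ** X = Y ** P"
  shows "P ** mat_exp X = mat_exp Y ** P"
proof -
  have pow: "P ** matpow X k = matpow Y k ** P" for k
  proof (induction k)
    case (Suc k)
    have "P ** matpow X (Suc k) = Y ** (P ** matpow X k)"
      by (simp add: matrix_mul_assoc assms)
    then show ?case by (simp add: Suc.IH matrix_mul_assoc)
  qed simp
  have l: "bounded_linear (\<lambda>A. P ** A)" and r: "bounded_linear (\<lambda>A. A ** P)"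
    by (rule bounded_bilinear.bounded_linear_right[OF bounded_bilinear_matrix_mult]
        bounded_bilinear.bounded_linear_left[OF bounded_bilinear_matrix_mult])+
  have "(\<lambda>k. (1 / fact k) *\<^sub>R (matpow Y k ** P)) sums (P ** mat_exp X)"
    using bounded_linear.sums[OF l mat_exp_sums[of X]] by (simp add: matrix_mult_simps pow)
  moreover have "(\<lambda>k. (1 / fact k) *\<^sub>R (matpow Y k ** P)) sums (mat_exp Y ** P)"
    using bounded_linear.sums[OF r mat_exp_sums[of Y]] by (simp add: matrix_mult_simps)
  ultimately show ?thesis by (rule sums_unique2)
qed

section \<open>Determinants of matrices in block form\<close>

lemma sign_map_permutation:
  assumes "finite A" "inj_on f A" "p permutes A"
  shows "sign (map_permutation A f p) = sign p"
  using assms(1,3)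
proof (induction rule: permutes_rev_induct)
  case id
  then show ?case using map_permutation_id'[OF assms(2)] by (simp add: id_def[symmetric])
next
  case (swap a b p)
  have fin: "finite (f ` A)" using assms(1) by simp
  have "map_permutation A f (p \<circ> Transposition.transpose a b) =
      map_permutation A f p \<circ> Transposition.transpose (f a) (f b)"
    using swap assms
    by (simp add: map_permutation_compose' map_permutation_transpose permutes_swap_id)
  moreover have "permutation (map_permutation A f p)"
    using map_permutation_permutes[OF inj_on_imp_bij_betw[OF assms(2)], of p] swap fin
      permutation_permutes by blast
  moreover have "permutation p" using swap assms(1) permutation_permutes by blast
  moreover have "f a = f b \<longleftrightarrow> a = b" using swap assms(2) by (auto dest: inj_onD)
  ultimately have "sign (map_permutation A f (p \<circ> Transposition.transpose a b)) =
      sign (p \<circ> Transposition.transpose a b)"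
    using swap by (simp add: sign_compose permutation_swap_id sign_swap_id)
  then show ?case by (simp add: o_def)
qed

text \<open>In the Leibniz expansion of \<open>det M\<close> only permutations that fix every index outside the range of \<open>f\<close>
  contribute, because the rows there are rows of the identity matrix. Relabelling along \<open>f\<close> identifies
  these with the permutations in the expansion of \<open>det A\<close>.\<close>

lemma det_embed:
  fixes A :: "'a::comm_ring_1^'m^'m" and M :: "'a^'k^'k" and f :: "'m \<Rightarrow> 'k"
  assumes f: "inj f"
    and M: "\<And>i j. M $ f i $ f j = A $ i $ j"
    and off: "\<And>p q. p \<notin> range f \<Longrightarrow> M $ p $ q = (if p = q then 1 else 0)"
  shows "det M = det A"
proof -
  let ?t = "\<lambda>p. of_int (sign p) * (\<Prod>i\<in>UNIV. M $ i $ p i)"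
  have "det M = sum ?t {p. p permutes range f}"
    unfolding det_def
  proof (rule sum.mono_neutral_right)
    show "finite {p. p permutes (UNIV::'k set)}" by (simp add: finite_permutations)
    show "{p. p permutes range f} \<subseteq> {p. p permutes UNIV}"
      by (auto intro: permutes_subset)
    show "\<forall>p\<in>{p. p permutes UNIV} - {p. p permutes range f}. ?t p = 0"
    proof
      fix p assume "p \<in> {p. p permutes UNIV} - {p. p permutes range f}"
      then have "p permutes UNIV" "\<not> p permutes range f" by auto
      then obtain x where x: "x \<notin> range f" "p x \<noteq> x"
        unfolding permutes_def by auto
      then have "(\<Prod>i\<in>UNIV. M $ i $ p i) = 0"
        using off[of x "p x"] by (intro prod_zero) auto
      then show "?t p = 0" by simp
    qed
  qed
  also have "\<dots> = (\<Sum>p\<in>{p. p permutes UNIV}. of_int (sign p) * (\<Prod>i\<in>UNIV. A $ i $ p i))"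
  proof (rule sum.reindex_bij_witness[where j = "map_permutation (range f) (inv f)"
        and i = "map_permutation UNIV f"])
    have b: "bij_betw f UNIV (range f)" using f by (rule inj_on_imp_bij_betw)
    have b': "bij_betw (inv f) (range f) UNIV" using b by (rule bij_betw_inv_into)
    fix p assume "p \<in> {p. p permutes range f}"
    then have p: "p permutes range f" by simp
    show "map_permutation (range f) (inv f) p \<in> {p. p permutes UNIV}"
      using map_permutation_permutes[OF b' p] by simp
    show "map_permutation UNIV f (map_permutation (range f) (inv f) p) = p"
      by (rule map_permutation_compose_inv[OF b' p]) (auto simp: f_inv_into_f)
    have ap: "map_permutation (range f) (inv f) p i = inv f (p (f i))" for i
      using map_permutation_apply[of "inv f" "range f" "f i" p] b' f
      by (simp add: bij_betw_def)
    have fp: "f (inv f (p (f i))) = p (f i)" for i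
      using p by (simp add: f_inv_into_f permutes_in_image)
    have "(\<Prod>i\<in>UNIV. M $ i $ p i) = (\<Prod>i\<in>range f. M $ i $ p i)"
      using p off by (intro prod.mono_neutral_right) (auto simp: permutes_not_in)
    also have "\<dots> = (\<Prod>i\<in>UNIV. M $ f i $ f (inv f (p (f i))))"
      using f by (simp add: prod.reindex fp)
    finally show "of_int (sign (map_permutation (range f) (inv f) p)) *
        (\<Prod>i\<in>UNIV. A $ i $ map_permutation (range f) (inv f) p i) = ?t p"
      using sign_map_permutation[OF _ bij_betw_imp_inj_on[OF b'] p]
      by (simp add: ap M)
  next
    have b: "bij_betw f UNIV (range f)" using f by (rule inj_on_imp_bij_betw)
    fix q :: "'m \<Rightarrow> 'm" assume "q \<in> {p. p permutes UNIV}"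
    then have q: "q permutes UNIV" by simp
    show "map_permutation UNIV f q \<in> {p. p permutes range f}"
      using map_permutation_permutes[OF b q] by simp
    show "map_permutation (range f) (inv f) (map_permutation UNIV f q) = q"
      by (rule map_permutation_compose_inv[OF b q]) (simp add: f)
  qed
  finally show ?thesis by (simp add: det_def)
qed

definition four_block ::
  "real^'m^'m \<Rightarrow> real^'n^'m \<Rightarrow> real^'m^'n \<Rightarrow> real^'n^'n \<Rightarrow> real^('m + 'n)^('m + 'n)" where
  "four_block A B C D = (\<chi> p q. case p of
      Inl i \<Rightarrow> (case q of Inl j \<Rightarrow> A $ i $ j | Inr j \<Rightarrow> B $ i $ j)
    | Inr i \<Rightarrow> (case q of Inl j \<Rightarrow> C $ i $ j | Inr j \<Rightarrow> D $ i $ j))"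

lemma four_block_mult:
  "four_block A B C D ** four_block A' B' C' D' =
   four_block (A ** A' + B ** C') (A ** B' + B ** D') (C ** A' + D ** C') (C ** B' + D ** D')"
proof -
  have "(\<Sum>r\<in>UNIV. F r) = (\<Sum>i\<in>UNIV. F (Inl i)) + (\<Sum>i\<in>UNIV. F (Inr i))" for F :: "'a + 'b \<Rightarrow> real"
    by (simp add: UNIV_Plus_UNIV[symmetric] sum.Plus del: UNIV_Plus_UNIV)
  then show ?thesis
    by (simp add: four_block_def matrix_matrix_mult_def vec_eq_iff split: sum.splits)
qed

lemma four_block_one: "four_block (mat 1) 0 0 (mat 1) = mat 1"
  by (simp add: four_block_def mat_def vec_eq_iff split: sum.splits)

lemma det_four_block_left: "det (four_block A 0 0 (mat 1)) = det A"
  by (rule det_embed[where f = Inl])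
    (auto simp: four_block_def mat_def image_iff split: sum.splits)

lemma det_four_block_right: "det (four_block (mat 1) 0 0 A) = det A"
  by (rule det_embed[where f = Inr])
    (auto simp: four_block_def mat_def image_iff split: sum.splits)

text \<open>Sylvester's determinant identity. The matrix with blocks \<open>I, -U, V, I\<close> has a block LU and a block
  UL factorisation; comparing determinants, the unipotent factors cancel and leave the two sides.\<close>

lemma det_one_plus_commute:
  fixes U :: "real^'n^'m" and V :: "real^'m^'n"
  shows "det (mat 1 + U ** V) = det (mat 1 + V ** U)"
proof -
  let ?upper = "\<lambda>U. four_block (mat 1) U 0 (mat 1) :: real^('m + 'n)^('m + 'n)"
  let ?lower = "\<lambda>V. four_block (mat 1) 0 V (mat 1) :: real^('m + 'n)^('m + 'n)"
  have "?lower V ** four_block (mat 1) 0 0 (mat 1 + V ** U) ** ?upper (- U) =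
      ?upper (- U) ** four_block (mat 1 + U ** V) 0 0 (mat 1) ** ?lower V"
    by (simp add: four_block_mult matrix_mult_simps matrix_mul_assoc)
  from arg_cong[where f = det, OF this]
  have "det (?lower V) * det (mat 1 + V ** U) * det (?upper (- U)) =
      det (?upper (- U)) * det (mat 1 + U ** V) * det (?lower V)"
    by (simp only: det_mul det_four_block_left det_four_block_right)
  moreover have "det (?lower V) \<noteq> 0"
  proof -
    have "?lower V ** ?lower (- V) = mat 1"
      by (simp add: four_block_mult four_block_one matrix_mult_simps)
    from arg_cong[where f = det, OF this] show ?thesis by (auto simp: det_mul)
  qed
  moreover have "det (?upper (- U)) \<noteq> 0"
  proof -
    have "?upper (- U) ** ?upper U = mat 1"
      by (simp add: four_block_mult four_block_one matrix_mult_simps)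
    from arg_cong[where f = det, OF this] show ?thesis by (auto simp: det_mul)
  qed
  ultimately show ?thesis by simp
qed

lemma det_diagonal_similar:
  fixes A :: "real^'m^'m"
  assumes "\<And>p. d p \<noteq> 0"
  shows "det (\<chi> p q. d p * A $ p $ q / d q) = det A"
proof -
  have "(\<Prod>i\<in>UNIV. d i * A $ i $ p i / d (p i)) = (\<Prod>i\<in>UNIV. A $ i $ p i)"
    if "p permutes UNIV" for p
  proof -
    have "(\<Prod>i\<in>UNIV. d (p i)) = (\<Prod>i\<in>UNIV. d i)"
      using prod.permute[OF that, of d] by (simp add: o_def)
    moreover have "(\<Prod>i\<in>UNIV. d i) \<noteq> 0" using assms by simp
    ultimately show ?thesis by (simp add: prod.distrib prod_dividef)
  qed
  then show ?thesis by (auto simp: det_def intro!: sum.cong)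
qed

text \<open>Conjugation by the diagonal matrix with entries \<open>r\<close> on \<open>S\<close> and 1 elsewhere multiplies the block
  that is to be erased by \<open>r\<close> and keeps the determinant. Letting \<open>r\<close> tend to 0 erases the block.\<close>

lemma det_block_triangular:
  fixes A :: "real^'m^'m"
  assumes "\<And>p q. p \<notin> S \<Longrightarrow> q \<in> S \<Longrightarrow> A $ p $ q = 0"
  shows "det (\<chi> p q. if p \<in> S \<and> q \<notin> S then 0 else A $ p $ q) = det A"
proof -
  define F where "F r = (\<chi> p q. if p \<in> S \<and> q \<notin> S then r * A $ p $ q else A $ p $ q)" for r
  have F: "det (F r) = det A" if "r \<noteq> 0" for r
  proof -
    let ?d = "\<lambda>p. if p \<in> S then r else 1"
    have "F r = (\<chi> p q. ?d p * A $ p $ q / ?d q)"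
      using assms that by (auto simp: F_def vec_eq_iff)
    then show ?thesis using det_diagonal_similar[of ?d A] that by simp
  qed
  have "((\<lambda>r. F r $ p $ q) \<longlongrightarrow> F 0 $ p $ q) (at 0)" for p q
    by (auto simp: F_def intro!: tendsto_eq_intros)
  then have "((\<lambda>r. det (F r)) \<longlongrightarrow> det (F 0)) (at 0)"
    unfolding det_def by (intro tendsto_sum tendsto_mult tendsto_const tendsto_prod)
  moreover have "((\<lambda>r. det (F r)) \<longlongrightarrow> det A) (at 0)"
    by (rule tendsto_eventually) (auto simp: eventually_at_filter F)
  ultimately have "det (F 0) = det A" by (rule tendsto_unique[rotated]) simp
  then show ?thesis by (simp add: F_def cong: if_cong)
qed

text \<open>The solution \<open>X\<close> of \<open>M X = U\<close> replaces \<open>M\<^sup>-\<^sup>1 U\<close> in the matrix determinant lemma; in the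
  application \<open>X\<close> is the column of stage derivatives.\<close>

lemma det_add_low_rank:
  fixes M :: "real^'m^'m" and X U :: "real^'n^'m" and V :: "real^'m^'n"
  assumes "M ** X = U"
  shows "det (M + U ** V) = det M * det (mat 1 + V ** X)"
proof -
  have "M + U ** V = M ** (mat 1 + X ** V)"
    by (simp add: matrix_mult_simps matrix_mul_assoc assms)
  then show ?thesis by (simp add: det_mul det_one_plus_commute[of X V])
qed

section \<open>Block matrices indexed by stages\<close>

definition block_column :: "('s \<Rightarrow> real^'n^'n) \<Rightarrow> real^'n^('s::finite \<times> 'n)" where
  "block_column W = (\<chi> p q. W (fst p) $ snd p $ q)"

definition block_row :: "('s \<Rightarrow> real^'n^'n) \<Rightarrow> real^('s::finite \<times> 'n)^'n" where
  "block_row V = (\<chi> p q. V (fst q) $ p $ snd q)"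

lemma sum_UNIV_prod: "(\<Sum>p\<in>UNIV. f p) = (\<Sum>i\<in>UNIV. \<Sum>a\<in>UNIV. f (i, a))"
  for f :: "'s::finite \<times> 'n::finite \<Rightarrow> real"
  by (simp add: UNIV_Times_UNIV[symmetric] sum.cartesian_product del: UNIV_Times_UNIV)

lemma block_matrix_mult:
  "block_matrix B ** block_matrix C = block_matrix (\<lambda>i k. \<Sum>j\<in>UNIV. B i j ** C j k)"
  by (simp add: block_matrix_def matrix_matrix_mult_def vec_eq_iff sum_UNIV_prod)

lemma block_matrix_mult_column:
  "block_matrix B ** block_column W = block_column (\<lambda>i. \<Sum>j\<in>UNIV. B i j ** W j)"
  by (simp add: block_matrix_def block_column_def matrix_matrix_mult_def vec_eq_iff sum_UNIV_prod)

lemma block_row_mult_column: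
  "block_row V ** block_column W = (\<Sum>j\<in>UNIV. V j ** W j)"
  by (simp add: block_row_def block_column_def matrix_matrix_mult_def vec_eq_iff sum_UNIV_prod)

lemma block_column_mult_row:
  "block_column W ** block_row V = block_matrix (\<lambda>i j. W i ** V j)"
  by (simp add: block_row_def block_column_def block_matrix_def matrix_matrix_mult_def vec_eq_iff)

lemma block_matrix_add: "block_matrix B + block_matrix C = block_matrix (\<lambda>i j. B i j + C i j)"
  by (simp add: block_matrix_def vec_eq_iff)

lemma block_matrix_one: "block_matrix (\<lambda>i j. if i = j then mat 1 else 0) = mat 1"
  by (auto simp: block_matrix_def mat_def vec_eq_iff prod_eq_iff)

lemma det_block_matrix_scale:
  assumes "\<And>i. d i \<noteq> 0"
  shows "det (block_matrix (\<lambda>i j. (d i / d j) *\<^sub>R B i j)) = det (block_matrix B)"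
  using det_diagonal_similar[of "d \<circ> fst" "block_matrix B"] assms
  by (simp add: block_matrix_def)

text \<open>The block matrices are conjugate by the block diagonal matrix with \<open>P\<close> in every diagonal position.\<close>

lemma det_block_matrix_similar:
  fixes P :: "real^'n^'n" and X Y :: "'s::finite \<Rightarrow> 's \<Rightarrow> real^'n^'n"
  assumes P: "invertible P" and XY: "\<And>i j. P ** X i j = Y i j ** P"
  shows "det (block_matrix X) = det (block_matrix Y)"
proof -
  let ?D = "\<lambda>P. block_matrix (\<lambda>i j. if i = j then P else 0) :: real^('s \<times> 'n)^('s \<times> 'n)"
  have D: "(\<Sum>j\<in>UNIV. (if i = j then A else 0) ** F j) = A ** F i"
      "(\<Sum>j\<in>UNIV. F j ** (if j = i then A else 0)) = F i ** A" for A :: "real^'n^'n" and F and i :: 's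
    by (simp_all add: if_distrib[of "\<lambda>x. x ** _"] if_distrib[of "\<lambda>x. _ ** x"] matrix_mult_simps
        cong: if_cong)
  obtain Q where Q: "P ** Q = mat 1" using P by (auto simp: invertible_def)
  have "P ** (if i = k then Q else 0) = (if i = k then mat 1 else 0)" for i k :: 's
    by (simp add: Q matrix_mult_simps)
  then have "?D P ** ?D Q = mat 1"
    by (simp only: block_matrix_mult D block_matrix_one)
  from arg_cong[where f = det, OF this] have "det (?D P) \<noteq> 0"
    by (auto simp: det_mul)
  moreover have "?D P ** block_matrix X = block_matrix Y ** ?D P"
    by (simp only: block_matrix_mult D XY)
  from arg_cong[where f = det, OF this]
  have "det (?D P) * det (block_matrix X) = det (block_matrix Y) * det (?D P)"
    by (simp only: det_mul)
  ultimately show ?thesis by simp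
qed

text \<open>If both factors are nonzero, a diagonal similarity turns \<open>s, t\<close> into \<open>t, s\<close>. If one of them
  vanishes, the matrix is block triangular and the other factor does not influence the determinant.\<close>

lemma det_block_matrix_swap_two:
  fixes B :: "2 \<Rightarrow> 2 \<Rightarrow> real^'n^'n" and s t :: real
  defines "F \<equiv> \<lambda>s t. block_matrix (\<lambda>i j. if i = j then B i j else (if i = 1 then s else t) *\<^sub>R B i j)"
  shows "det (F s t) = det (F t s)"
proof -
  have two: "x \<noteq> 1 \<longleftrightarrow> x = 2" "x \<noteq> 2 \<longleftrightarrow> x = 1" for x :: 2
    using exhaust_2[of x] by auto
  have z2: "det (F s 0) = det (F 0 0)" for s
  proof -
    have "det (\<chi> p q. if p \<in> {1} \<times> UNIV \<and> q \<notin> {1} \<times> UNIV then 0 else F s 0 $ p $ q) = det (F s 0)"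
      by (rule det_block_triangular) (auto simp: F_def block_matrix_def two)
    moreover have "(\<chi> p q. if p \<in> {1} \<times> UNIV \<and> q \<notin> {1} \<times> UNIV then 0 else F s 0 $ p $ q) = F 0 0"
      by (auto simp: F_def block_matrix_def vec_eq_iff two)
    ultimately show ?thesis by simp
  qed
  have z1: "det (F 0 s) = det (F 0 0)" for s
  proof -
    have "det (\<chi> p q. if p \<in> {2} \<times> UNIV \<and> q \<notin> {2} \<times> UNIV then 0 else F 0 s $ p $ q) = det (F 0 s)"
      by (rule det_block_triangular) (auto simp: F_def block_matrix_def two)
    moreover have "(\<chi> p q. if p \<in> {2} \<times> UNIV \<and> q \<notin> {2} \<times> UNIV then 0 else F 0 s $ p $ q) = F 0 0"
      by (auto simp: F_def block_matrix_def vec_eq_iff two)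
    ultimately show ?thesis by simp
  qed
  show ?thesis
  proof (cases "s = 0 \<or> t = 0")
    case True
    then show ?thesis using z1[of s] z2[of s] z1[of t] z2[of t] by auto
  next
    case False
    \<comment> \<open>This multiplies the upper right block by \<open>t / s\<close> and divides the lower left block by it.\<close>
    let ?d = "\<lambda>i::2. if i = 1 then t / s else 1"
    have "F t s = block_matrix (\<lambda>i j. (?d i / ?d j) *\<^sub>R
        (if i = j then B i j else (if i = 1 then s else t) *\<^sub>R B i j))"
      unfolding F_def
    proof (intro arg_cong[where f = block_matrix] ext)
      fix i j :: 2
      show "(if i = j then B i j else (if i = 1 then t else s) *\<^sub>R B i j) = (?d i / ?d j) *\<^sub>R
        (if i = j then B i j else (if i = 1 then s else t) *\<^sub>R B i j)"
        using False exhaust_2[of i] exhaust_2[of j] by (elim disjE) simp_all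
    qed
    also have "det \<dots> = det (F s t)"
      unfolding F_def by (rule det_block_matrix_scale) (use False in auto)
    finally show ?thesis by simp
  qed
qed

section \<open>Jacobian of an SSEI step\<close>

text \<open>Conjugation by \<open>P\<close> gives \<open>det e\<^sup>h\<^sup>K = det e\<^sup>-\<^sup>h\<^sup>K\<close>, so the square of this determinant is 1. It is
  not \<open>-1\<close>, being the square of the determinant for \<open>h / 2\<close>.\<close>

lemma det_mat_exp_eq_one:
  fixes K P :: "real^'n^'n"
  assumes P: "invertible P" and PK: "P ** K = - K ** P"
  shows "det (mat_exp (h *\<^sub>R K)) = 1"
proof -
  let ?d = "\<lambda>h. det (mat_exp (h *\<^sub>R K))"
  have add: "?d s * ?d t = ?d (s + t)" for s t
    by (simp flip: det_mul add: mat_exp_add)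
  have "P ** mat_exp (h *\<^sub>R K) = mat_exp ((- h) *\<^sub>R K) ** P"
    by (rule mat_exp_intertwine) (simp add: matrix_mult_simps PK)
  from arg_cong[where f = det, OF this] have sym: "?d h = ?d (- h)"
    using P by (simp add: det_mul invertible_det_nz)
  have "?d h * ?d h = 1"
    using add[of h "- h"] sym by simp
  moreover have "?d h = ?d (h / 2) * ?d (h / 2)"
    using add[of "h / 2" "h / 2"] by simp
  then have "?d h \<ge> 0" by simp
  ultimately show ?thesis
    using square_eq_1_iff[of "?d h"] by auto
qed

text \<open>The matrix of the linearised stage equations when \<open>g'\<close> takes the value \<open>G j\<close> at the \<open>j\<close>-th stage.
  The tableau is a parameter so that the one with \<open>A\<close> transposed and \<open>c\<close> negated is covered too.\<close>

definition stage_matrix ::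
  "real^'n^'n \<Rightarrow> real \<Rightarrow> real^'s \<Rightarrow> real^'s^'s \<Rightarrow> ('s \<Rightarrow> real^'n^'n) \<Rightarrow> real^('s \<times> 'n)^('s \<times> 'n)" where
  "stage_matrix K h c A G = block_matrix (\<lambda>i j. (if i = j then mat 1 else 0)
     - (h * A$i$j) *\<^sub>R (mat_exp (((c$i - c$j) * h) *\<^sub>R K) ** G j))"

text \<open>This is the linear algebra of one step: the column \<open>X\<close> satisfies the linearised stage equations and
  the first determinant is that of the step's derivative.
  Adding the block matrix \<open>U V\<close> replaces \<open>a\<^sub>i\<^sub>j\<close> by \<open>a\<^sub>i\<^sub>j - b\<^sub>j\<close> in the stage matrix; by
  symplecticity the result is similar to the stage matrix of the transposed tableau with the sign
  of every \<open>G j\<close> reversed, and conjugation by \<open>P\<close> restores the sign at the price of inverting the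
  exponentials, which is the change from \<open>c\<close> to \<open>- c\<close>.\<close>

lemma det_SSEI_tangent:
  fixes K P :: "real^'n^'n" and c b :: "real^'s" and A :: "real^'s^'s"
  assumes P: "invertible P" and PK: "P ** K = - K ** P" and PG: "\<And>j. P ** G j = - G j ** P"
    and symp: "symplectic_RK b A" and b: "\<And>j. b$j \<noteq> 0"
    and X: "\<And>i. X i = mat_exp ((c$i * h) *\<^sub>R K)
        + h *\<^sub>R (\<Sum>j\<in>UNIV. A$i$j *\<^sub>R (mat_exp (((c$i - c$j) * h) *\<^sub>R K) ** G j ** X j))"
  shows "det (mat_exp (h *\<^sub>R K)
        + h *\<^sub>R (\<Sum>i\<in>UNIV. b$i *\<^sub>R (mat_exp (((1 - c$i) * h) *\<^sub>R K) ** G i ** X i)))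
      * det (stage_matrix K h c A G) = det (stage_matrix K h (- c) (transpose A) G)"
    (is "det ?D * det ?M = det ?N")
proof -
  define e where "e x = mat_exp ((x * h) *\<^sub>R K)" for x
  have e: "e x ** e y = e (x + y)" for x y
    by (simp add: e_def mat_exp_add distrib_right)
  have e1: "mat_exp (h *\<^sub>R K) = e 1"
    by (simp add: e_def)
  have e': "e x ** (e y ** Z) = e (x + y) ** Z" for x y and Z :: "real^'n^'n"
    by (simp add: matrix_mul_assoc e)
  define V where "V = (\<lambda>j. (h * b$j) *\<^sub>R (e (- c$j) ** G j))"
  define U where "U = (\<lambda>i. e (c$i))"
  have "(\<Sum>j\<in>UNIV. ((if i = j then mat 1 else 0) - (h * A$i$j) *\<^sub>R (e (c$i - c$j) ** G j)) ** X j)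
      = U i" for i
  proof -
    have "(\<Sum>j\<in>UNIV. (if i = j then mat 1 else 0) ** X j) = X i"
      by (simp add: if_distrib[of "\<lambda>x. x ** _"] matrix_mult_simps cong: if_cong)
    then show ?thesis
      using X[of i, folded e_def]
      by (simp add: matrix_mult_simps sum_subtractf scaleR_sum_right U_def)
  qed
  then have MX: "?M ** block_column X = block_column U"
    unfolding stage_matrix_def block_matrix_mult_column e_def by simp
  have "e 1 ** (mat 1 + block_row V ** block_column X) = ?D"
    unfolding e1 e_def[symmetric]
    by (simp add: block_row_mult_column V_def matrix_mult_simps matrix_mul_assoc[symmetric]
        e' scaleR_sum_right)
  moreover have "det (e 1) = 1"
    using det_mat_exp_eq_one[OF P PK, of h] by (simp add: e1)
  ultimately have "det ?D = det (mat 1 + block_row V ** block_column X)"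
    using det_mul[of "e 1" "mat 1 + block_row V ** block_column X"] by simp
  then have "det ?D * det ?M = det (?M + block_column U ** block_row V)"
    by (simp add: det_add_low_rank[OF MX])
  also have "?M + block_column U ** block_row V = block_matrix (\<lambda>i j. (b$j / b$i) *\<^sub>R
      ((if i = j then mat 1 else 0) + (h * A$j$i) *\<^sub>R (e (c$i - c$j) ** G j)))"
  proof -
    have "(if i = j then mat 1 else 0) - (h * A$i$j) *\<^sub>R (e (c$i - c$j) ** G j) + U i ** V j =
      (b$j / b$i) *\<^sub>R ((if i = j then mat 1 else 0) + (h * A$j$i) *\<^sub>R (e (c$i - c$j) ** G j))" for i j
    proof -
      have UV: "U i ** V j = (h * b$j) *\<^sub>R (e (c$i - c$j) ** G j)"
        by (simp add: U_def V_def matrix_mult_simps e')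
      \<comment> \<open>the symplecticity condition divided by \<open>b$i\<close>\<close>
      have "b$j - A$i$j = b$j / b$i * A$j$i"
        using symp b[of i] unfolding symplectic_RK_def by (auto simp: field_simps)
      then have "h * b$j - h * A$i$j = b$j / b$i * (h * A$j$i)"
        by (metis mult.left_commute right_diff_distrib)
      then show ?thesis
        using b[of i] unfolding UV
        by (auto simp: scaleR_add_right scaleR_left_diff_distrib[symmetric])
    qed
    then show ?thesis
      by (simp add: stage_matrix_def block_column_mult_row block_matrix_add flip: e_def)
  qed
  also have "det \<dots> = det (block_matrix (\<lambda>i j.
      (if i = j then mat 1 else 0) + (h * A$j$i) *\<^sub>R (e (c$i - c$j) ** G j)))"
    using det_block_matrix_scale[of "\<lambda>i. 1 / b$i"] b by simp
  also have "\<dots> = det ?N"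
    unfolding stage_matrix_def e_def[symmetric]
  proof (rule det_block_matrix_similar[OF P])
    fix i j
    have "P ** e (c$i - c$j) = e (c$j - c$i) ** P"
      unfolding e_def
    proof (rule mat_exp_intertwine)
      show "P ** (((c$i - c$j) * h) *\<^sub>R K) = (((c$j - c$i) * h) *\<^sub>R K) ** P"
        by (simp add: matrix_mult_simps PK) (simp add: algebra_simps)
    qed
    then have "P ** (e (c$i - c$j) ** G j) = - (e (c$j - c$i) ** G j) ** P"
      by (simp add: matrix_mul_assoc) (simp add: matrix_mul_assoc[symmetric] PG matrix_mult_simps)
    then show "P ** ((if i = j then mat 1 else 0) + (h * A$j$i) *\<^sub>R (e (c$i - c$j) ** G j)) =
      ((if i = j then mat 1 else 0) - (h * transpose A$i$j) *\<^sub>R (e ((- c)$i - (- c)$j) ** G j)) ** P"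
      by (simp add: matrix_mult_simps transpose_def)
  qed
  finally show ?thesis .
qed

text \<open>The stage equations and the step have the same shape, a matrix combination of \<open>y\<close> and the values
  \<open>g (k j y)\<close>, so this one formula differentiates both.\<close>

lemma has_derivative_stage_combination:
  fixes g :: "real^'n \<Rightarrow> real^'n" and k :: "'s::finite \<Rightarrow> real^'n \<Rightarrow> real^'n"
    and E :: "real^'n^'n" and Y :: "'s \<Rightarrow> real^'n^'n"
  assumes g: "\<And>j. (g has_derivative (\<lambda>v. G j *v v)) (at (k j y))"
    and k: "\<And>j. (k j has_derivative (\<lambda>v. X j *v v)) (at y)"
  shows "((\<lambda>y. E *v y + h *\<^sub>R (\<Sum>j\<in>UNIV. w j *\<^sub>R (Y j *v g (k j y)))) has_derivative
     (\<lambda>v. (E + h *\<^sub>R (\<Sum>j\<in>UNIV. w j *\<^sub>R (Y j ** G j ** X j))) *v v)) (at y)"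
proof -
  have gk: "((\<lambda>y. g (k j y)) has_derivative (\<lambda>v. G j *v (X j *v v))) (at y)" for j
    using diff_chain_at[OF k g] by (simp add: o_def)
  have sum: "(\<Sum>j\<in>UNIV. F j) *v v = (\<Sum>j\<in>UNIV. F j *v v)" for F :: "'s \<Rightarrow> real^'n^'n" and v
    by (induction rule: infinite_finite_induct) (simp_all add: matrix_vector_mult_add_rdistrib)
  have sc: "(r *\<^sub>R Z) *v v = r *\<^sub>R (Z *v v)" for r and Z :: "real^'n^'n" and v
    by (simp add: scaleR_matrix_vector_assoc)
  show ?thesis
  proof (rule has_derivative_eq_rhs)
    show "((\<lambda>y. E *v y + h *\<^sub>R (\<Sum>j\<in>UNIV. w j *\<^sub>R (Y j *v g (k j y)))) has_derivative
        (\<lambda>v. E *v v + h *\<^sub>R (\<Sum>j\<in>UNIV. w j *\<^sub>R (Y j *v (G j *v (X j *v v)))))) (at y)"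
      by (intro has_derivative_add has_derivative_scaleR_right has_derivative_sum has_derivative_ident gk
          bounded_linear.has_derivative[OF matrix_vector_mul_bounded_linear])
    show "(\<lambda>v. E *v v + h *\<^sub>R (\<Sum>j\<in>UNIV. w j *\<^sub>R (Y j *v (G j *v (X j *v v))))) =
        (\<lambda>v. (E + h *\<^sub>R (\<Sum>j\<in>UNIV. w j *\<^sub>R (Y j ** G j ** X j))) *v v)"
      by (rule ext) (simp only: matrix_vector_mult_add_rdistrib sum sc matrix_vector_mul_assoc matrix_mul_assoc)
  qed
qed

lemma jacobian_unique:
  fixes f :: "real^'n \<Rightarrow> real^'m"
  assumes "(f has_derivative (\<lambda>v. D *v v)) (at y)"
  shows "jacobian f (at y) = D"
  using frechet_derivative_at[OF assms, symmetric] by (simp add: jacobian_def)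

lemma SSEI_step_jacobian:
  fixes K P :: "real^'n^'n" and c b :: "real^'s" and A :: "real^'s^'s"
  assumes P: "invertible P" and PK: "P ** K = - K ** P"
    and PG: "\<And>y. P ** jacobian g (at y) = - jacobian g (at y) ** P"
    and g: "\<And>y. g differentiable (at y)"
    and symp: "symplectic_RK b A" and b: "\<And>j. b$j \<noteq> 0"
    and k: "SSEI_stages K g h c A k"
  defines "G \<equiv> \<lambda>y j. jacobian g (at (k j y))"
  shows "SSEI_step K g h c b k differentiable (at y)"
    and "det (jacobian (SSEI_step K g h c b k) (at y)) * det (stage_matrix K h c A (G y)) =
         det (stage_matrix K h (- c) (transpose A) (G y))"
    and "det (stage_matrix K h c A (G y)) \<noteq> 0"
proof -
  define X where "X j = jacobian (k j) (at y)" for j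
  have kX: "(k j has_derivative (\<lambda>v. X j *v v)) (at y)" for j
    using k unfolding SSEI_stages_def X_def jacobian_works[symmetric] by blast
  have gG: "(g has_derivative (\<lambda>v. G y j *v v)) (at (k j y))" for j
    using g unfolding G_def jacobian_works[symmetric] by blast
  have "k i = (\<lambda>y. mat_exp ((c$i * h) *\<^sub>R K) *v y
        + h *\<^sub>R (\<Sum>j\<in>UNIV. A$i$j *\<^sub>R (mat_exp (((c$i - c$j) * h) *\<^sub>R K) *v g (k j y))))" for i
    using k unfolding SSEI_stages_def by blast
  note k_eq = this
  have X: "X i = mat_exp ((c$i * h) *\<^sub>R K)
      + h *\<^sub>R (\<Sum>j\<in>UNIV. A$i$j *\<^sub>R (mat_exp (((c$i - c$j) * h) *\<^sub>R K) ** G y j ** X j))" for i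
    unfolding X_def[of i]
    by (rule jacobian_unique) (subst k_eq[of i], rule has_derivative_stage_combination[OF gG kX])
  have D: "(SSEI_step K g h c b k has_derivative (\<lambda>v. (mat_exp (h *\<^sub>R K)
      + h *\<^sub>R (\<Sum>i\<in>UNIV. b$i *\<^sub>R (mat_exp (((1 - c$i) * h) *\<^sub>R K) ** G y i ** X i))) *v v)) (at y)"
    unfolding SSEI_step_def[abs_def] by (rule has_derivative_stage_combination[OF gG kX])
  then show "SSEI_step K g h c b k differentiable (at y)"
    by (rule differentiableI)
  show "det (jacobian (SSEI_step K g h c b k) (at y)) * det (stage_matrix K h c A (G y)) =
         det (stage_matrix K h (- c) (transpose A) (G y))"
    unfolding jacobian_unique[OF D]
    by (rule det_SSEI_tangent[OF P PK _ symp b X]) (simp add: G_def PG)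
  show "det (stage_matrix K h c A (G y)) \<noteq> 0"
    using k unfolding SSEI_stages_def stage_matrix_def G_def invertible_det_nz by blast
qed

text \<open>For any number of stages, volume preservation reduces to a symmetry of the stage determinant
  under transposing \<open>A\<close> and negating \<open>c\<close>: the Jacobian determinant is the quotient of the two, and
  the invertibility demanded of the stage equations makes the denominator nonzero.\<close>

lemma SSEI_volume_preservingI:
  fixes K P :: "real^'n^'n" and c b :: "real^'s" and A :: "real^'s^'s"
  assumes P: "invertible P" and PK: "P ** K = - K ** P"
    and PG: "\<And>y. P ** jacobian g (at y) = - jacobian g (at y) ** P"
    and g: "\<And>y. g differentiable (at y)"
    and m: "SSEI_method K g h c b A \<phi>"
    and eq: "\<And>G. det (stage_matrix K h (- c) (transpose A) G) = det (stage_matrix K h c A G)"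
  shows "volume_preserving \<phi>"
proof -
  obtain k where k: "SSEI_stages K g h c A k" "\<phi> = SSEI_step K g h c b k"
    and b: "symplectic_RK b A" "\<And>j. b$j \<noteq> 0"
    using m unfolding SSEI_method_def by blast
  note J = SSEI_step_jacobian[OF P PK PG g b k(1)]
  show ?thesis
    unfolding volume_preserving_def k(2) using J eq by auto
qed

section \<open>Methods with one or two stages\<close>

lemma stage_matrix_one_stage:
  fixes c :: "real^1"
  shows "stage_matrix K h (- c) (transpose A) G = stage_matrix K h c A G"
  unfolding stage_matrix_def
proof (intro arg_cong[where f = block_matrix] ext)
  fix i j :: 1
  have "j = i" by (simp add: num1_eq_iff)
  then show "(if i = j then mat 1 else 0)
      - (h * transpose A$i$j) *\<^sub>R (mat_exp ((((- c)$i - (- c)$j) * h) *\<^sub>R K) ** G j) =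
    (if i = j then mat 1 else 0) - (h * A$i$j) *\<^sub>R (mat_exp (((c$i - c$j) * h) *\<^sub>R K) ** G j)"
    by (simp add: transpose_def)
qed

text \<open>With equal nodes all exponentials are \<open>I\<close>, so negating \<open>c\<close> changes nothing and transposing \<open>A\<close>
  exchanges the scalars in front of the off-diagonal blocks.\<close>

lemma det_stage_matrix_two_stage:
  fixes c :: "real^2"
  assumes "c$1 = c$2"
  shows "det (stage_matrix K h (- c) (transpose A) G) = det (stage_matrix K h c A G)"
proof -
  have c: "c$2 = c$1" using assms by simp
  let ?B = "\<lambda>i j. if i = j then mat 1 - (h * A$i$i) *\<^sub>R G i else G j"
  let ?F = "\<lambda>s t. block_matrix (\<lambda>i j. if i = j then ?B i j else (if i = 1 then s else t) *\<^sub>R ?B i j)"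
  have "stage_matrix K h c A G = ?F (- (h * A$1$2)) (- (h * A$2$1))"
    unfolding stage_matrix_def
  proof (intro arg_cong[where f = block_matrix] ext)
    fix i j :: 2
    show "(if i = j then mat 1 else 0)
        - (h * A$i$j) *\<^sub>R (mat_exp (((c$i - c$j) * h) *\<^sub>R K) ** G j) =
      (if i = j then ?B i j
       else (if i = 1 then - (h * A$1$2) else - (h * A$2$1)) *\<^sub>R ?B i j)"
      using exhaust_2[of i] exhaust_2[of j] by (elim disjE) (simp_all add: c)
  qed
  moreover have "stage_matrix K h (- c) (transpose A) G = ?F (- (h * A$2$1)) (- (h * A$1$2))"
    unfolding stage_matrix_def
  proof (intro arg_cong[where f = block_matrix] ext)
    fix i j :: 2
    show "(if i = j then mat 1 else 0)
        - (h * transpose A$i$j) *\<^sub>R (mat_exp ((((- c)$i - (- c)$j) * h) *\<^sub>R K) ** G j) =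
      (if i = j then ?B i j
       else (if i = 1 then - (h * A$2$1) else - (h * A$1$2)) *\<^sub>R ?B i j)"
      using exhaust_2[of i] exhaust_2[of j]
      by (elim disjE) (simp_all add: c transpose_def)
  qed
  ultimately show ?thesis
    using det_block_matrix_swap_two[of ?B "- (h * A$1$2)" "- (h * A$2$1)"] by simp
qed

section \<open>Compositions and the volume preservation theorem\<close>

lemma volume_preserving_comp:
  fixes \<phi> \<psi> :: "real^'n \<Rightarrow> real^'n"
  assumes "volume_preserving \<phi>" "volume_preserving \<psi>"
  shows "volume_preserving (\<phi> \<circ> \<psi>)"
  unfolding volume_preserving_def
proof (intro allI)
  fix y
  have "(\<phi> has_derivative (\<lambda>v. jacobian \<phi> (at (\<psi> y)) *v v)) (at (\<psi> y))"
    "(\<psi> has_derivative (\<lambda>v. jacobian \<psi> (at y) *v v)) (at y)"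
    using assms by (simp_all add: volume_preserving_def flip: jacobian_works)
  from diff_chain_at[OF this(2,1)]
  have d: "(\<phi> \<circ> \<psi> has_derivative (\<lambda>v. (jacobian \<phi> (at (\<psi> y)) ** jacobian \<psi> (at y)) *v v)) (at y)"
    by (simp add: o_def matrix_vector_mul_assoc)
  then show "\<phi> \<circ> \<psi> differentiable at y \<and> det (jacobian (\<phi> \<circ> \<psi>) (at y)) = 1"
    using assms by (auto simp: jacobian_unique[OF d] det_mul volume_preserving_def intro: differentiableI)
qed

theorem theorem4p4:
  fixes K :: "real^'n^'n" and f g :: "real^'n \<Rightarrow> real^'n"
  assumes f_def: "\<And>y. f y = K *v y + g y"
    and detK: "\<And>h::real. 0 < h \<Longrightarrow> h < 1 \<Longrightarrow> det (mat_exp (h *\<^sub>R K)) \<noteq> -1"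
    and g_diff: "\<And>y. g differentiable (at y)"
    and f_div: "divergence_free f"
    and f_g_S: "\<exists>P. f \<in> class_S_with P \<and> g \<in> class_S_with P"
  shows "(\<forall>\<phi> \<in> one_stage_SSEI K g. volume_preserving \<phi>) \<and>
         (\<forall>\<phi> \<in> two_stage_SSEI_eq K g. volume_preserving \<phi>) \<and>
         (\<forall>\<phi> \<in> compositions (one_stage_SSEI K g \<union> two_stage_SSEI_eq K g).
            volume_preserving \<phi>)"
proof -
  obtain P where "f \<in> class_S_with P" "g \<in> class_S_with P"
    using f_g_S by blast
  then have P: "invertible P"
    and f: "\<And>y. P ** jacobian f (at y) ** matrix_inv P = - jacobian f (at y)"
    and g: "\<And>y. P ** jacobian g (at y) ** matrix_inv P = - jacobian g (at y)"
    by (auto simp: class_S_with_def)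
  have inv: "matrix_inv P ** P = mat 1"
    using P unfolding invertible_def matrix_inv_def by (rule someI2_ex) auto
  \<comment> \<open>Multiplying by \<open>P\<close> on the right removes the inverse from the defining relation of the class.\<close>
  have anti: "P ** Z = - Z ** P" if "P ** Z ** matrix_inv P = - Z" for Z
    using arg_cong[where f = "\<lambda>Z. Z ** P", OF that] inv
    by (simp flip: matrix_mul_assoc)
  have PG: "P ** jacobian g (at y) = - jacobian g (at y) ** P" for y
    by (rule anti[OF g])
  have "((\<lambda>y. K *v y + g y) has_derivative (\<lambda>v. (K + jacobian g (at y)) *v v)) (at y)" for y
    using g_diff[of y] unfolding jacobian_works
    by (auto intro!: derivative_eq_intros
          bounded_linear.has_derivative[OF matrix_vector_mul_bounded_linear]
        simp: matrix_vector_mult_add_rdistrib)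
  then have "jacobian f (at 0) = K + jacobian g (at 0)"
    using f_def by (intro jacobian_unique) presburger
  then have PK: "P ** K = - K ** P"
    using anti[OF f, of 0] PG[of 0] by (simp add: matrix_mult_simps)
  note vp = SSEI_volume_preservingI[OF P PK PG g_diff]
  have one: "volume_preserving \<phi>" if "\<phi> \<in> one_stage_SSEI K g" for \<phi>
    using that unfolding one_stage_SSEI_def by (auto intro: vp simp: stage_matrix_one_stage)
  have two: "volume_preserving \<phi>" if "\<phi> \<in> two_stage_SSEI_eq K g" for \<phi>
    using that unfolding two_stage_SSEI_eq_def by (auto intro: vp det_stage_matrix_two_stage)
  have "volume_preserving \<phi>"
    if "\<phi> \<in> compositions (one_stage_SSEI K g \<union> two_stage_SSEI_eq K g)" for \<phi>
    using that
  proof induction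
    case (base \<phi>)
    then show ?case using one two by blast
  next
    case (comp \<phi> \<psi>)
    then show ?case by (intro volume_preserving_comp)
  qed
  with one two show ?thesis by blast
qed

end
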